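(* For every integer $n\ge 0$, the smallest eigenvalue $\lambda_s$ of the matrix $G_n$ satisfies $$\lambda_s\ge\max\left\{\frac{1}{\sum_{\ell=0}^{n}\sum_{j=0}^{\ell}|a_{\ell,j}|^{2}},\ \frac{1}{\sum_{\ell=0}^{n}\left(\sum_{j=0}^{\ell}|a_{\ell,j}|\right)^{2}}\right\}.$$
   Context: $E$ is a complex inner product space whose inner product $(\cdot,\cdot)$ is linear in the first and conjugate-linear in the second argument, and $\{u_n\}_{n=0}^\infty$ is a sequence of linearly independent vectors in $E$. Put $G_n=(m_{j,k})_{j,k=0}^n$ with $m_{j,k}=(u_j,u_k)$; it is positive definite. Let $\{p_n\}_{n=0}^\infty$ be the unique orthonormal system obtained from $\{u_n\}$ by Gram--Schmidt, $p_n=\sum_{j=0}^n a_{n,j}u_j$ with $a_{n,n}>0$. *)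

theory Defs
  imports
    "HOL-Analysis.Analysis"
    "Jordan_Normal_Form.Spectral_Radius"
begin

text \<open>
  The underlying space is a whole type, as for the library locale \<open>vector_space\<close>; the scalar
  multiplication is a parameter because the library has no type class of complex vector spaces.
  Positivity is stated for real and imaginary parts separately, so that \<open>ip x x\<close> is real by axiom
  \<open>ip_commute\<close> and only its real part needs to be constrained.
\<close>

locale complex_inner_product_space = Vector_Spaces.vector_space smul
  for smul :: "complex \<Rightarrow> 'a::ab_group_add \<Rightarrow> 'a" +
  fixes ip :: "'a \<Rightarrow> 'a \<Rightarrow> complex"
  assumes ip_add_left: "ip (x + y) z = ip x z + ip y z"
    and ip_scale_left: "ip (smul c x) z = c * ip x z"
    and ip_commute: "ip y x = cnj (ip x y)"
    and ip_pos: "x \<noteq> 0 \<Longrightarrow> 0 < Re (ip x x)"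

text \<open>Injectivity is needed because dependence of the set \<open>range u\<close> ignores repetitions.\<close>

definition lin_indep_seq :: "(complex \<Rightarrow> 'a::ab_group_add \<Rightarrow> 'a) \<Rightarrow> (nat \<Rightarrow> 'a) \<Rightarrow> bool" where
  "lin_indep_seq smul u \<longleftrightarrow> inj u \<and> \<not> module.dependent smul (range u)"

definition gram_matrix :: "('a \<Rightarrow> 'a \<Rightarrow> complex) \<Rightarrow> (nat \<Rightarrow> 'a) \<Rightarrow> nat \<Rightarrow> complex mat" where
  "gram_matrix ip u n = mat (Suc n) (Suc n) (\<lambda>(j, k). ip (u j) (u k))"

definition normalize_vec ::
  "(complex \<Rightarrow> 'a \<Rightarrow> 'a) \<Rightarrow> ('a \<Rightarrow> 'a \<Rightarrow> complex) \<Rightarrow> 'a \<Rightarrow> 'a" where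
  "normalize_vec smul ip v = smul (complex_of_real (1 / sqrt (Re (ip v v)))) v"

fun gram_schmidt_seq ::
  "(complex \<Rightarrow> 'a::ab_group_add \<Rightarrow> 'a) \<Rightarrow> ('a \<Rightarrow> 'a \<Rightarrow> complex) \<Rightarrow> (nat \<Rightarrow> 'a) \<Rightarrow> nat \<Rightarrow> 'a" where
  "gram_schmidt_seq smul ip u n =
     normalize_vec smul ip
       (u n - (\<Sum>k<n. smul (ip (u n) (gram_schmidt_seq smul ip u k)) (gram_schmidt_seq smul ip u k)))"

declare gram_schmidt_seq.simps [simp del]

text \<open>
  For the Gram matrix of a linearly independent sequence this set of reals consists of all
  eigenvalues and is finite and nonempty; see \<open>gram_matrix_eigenvalue_real\<close> and
  \<open>gram_matrix_eigenvalues\<close> below.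
\<close>

definition smallest_eigenvalue :: "complex mat \<Rightarrow> real" where
  "smallest_eigenvalue A = Min {x. eigenvalue A (complex_of_real x)}"

context complex_inner_product_space
begin

lemma ip_add_right: "ip z (x + y) = ip z x + ip z y"
  by (metis ip_commute ip_add_left complex_cnj_add)

lemma ip_scale_right: "ip z (smul c x) = cnj c * ip z x"
  by (metis ip_commute ip_scale_left complex_cnj_mult)

lemma ip_zero_left: "ip 0 z = 0"
  using ip_add_left[of 0 0 z] by simp

lemma ip_zero_right: "ip z 0 = 0"
  using ip_add_right[of z 0 0] by simp

lemma ip_sum_left: "ip (\<Sum>i\<in>A. f i) z = (\<Sum>i\<in>A. ip (f i) z)"
  by (induction A rule: infinite_finite_induct) (auto simp: ip_zero_left ip_add_left)

lemma ip_sum_right: "ip z (\<Sum>i\<in>A. f i) = (\<Sum>i\<in>A. ip z (f i))"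
  by (induction A rule: infinite_finite_induct) (auto simp: ip_zero_right ip_add_right)

lemma ip_minus_left: "ip (x - y) z = ip x z - ip y z"
  using ip_add_left[of "x - y" y z] by simp

lemma ip_self: "ip x x = complex_of_real (Re (ip x x))"
  using ip_commute[of x x] by (metis Reals_cnj_iff of_real_Re)

lemma gram_matrix_eigenvalue_real:
  assumes "eigenvalue (gram_matrix ip u n) z"
  shows "z \<in> \<real>"
proof -
  let ?N = "{..<Suc n}"
  from assms obtain v where v: "v \<in> carrier_vec (Suc n)" "v \<noteq> 0\<^sub>v (Suc n)"
    and ev: "gram_matrix ip u n *\<^sub>v v = z \<cdot>\<^sub>v v"
    by (auto simp: eigenvalue_def eigenvector_def gram_matrix_def)
  define w where "w = (\<Sum>k\<in>?N. smul (cnj (v $ k)) (u k))"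
  define q :: real where "q = (\<Sum>k\<in>?N. (cmod (v $ k))\<^sup>2)"
  have comp: "ip (u j) w = z * v $ j" if j: "j < Suc n" for j
  proof -
    have "(gram_matrix ip u n *\<^sub>v v) $ j = (z \<cdot>\<^sub>v v) $ j"
      using ev by simp
    moreover have "(gram_matrix ip u n *\<^sub>v v) $ j = (\<Sum>k\<in>?N. ip (u j) (u k) * v $ k)"
      using v j by (auto simp: gram_matrix_def scalar_prod_def lessThan_atLeast0 intro!: sum.cong)
    moreover have "ip (u j) w = (\<Sum>k\<in>?N. ip (u j) (u k) * v $ k)"
      by (simp add: w_def ip_sum_right ip_scale_right mult.commute del: sum.lessThan_Suc)
    ultimately show ?thesis using v j by simp
  qed
  have "ip w w = (\<Sum>j\<in>?N. cnj (v $ j) * ip (u j) w)"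
    by (subst w_def) (simp add: ip_sum_left ip_scale_left del: sum.lessThan_Suc)
  also have "\<dots> = (\<Sum>j\<in>?N. z * complex_of_real ((cmod (v $ j))\<^sup>2))"
    by (rule sum.cong) (auto simp: comp complex_norm_square mult_ac simp del: of_real_power)
  also have "\<dots> = z * complex_of_real q"
    by (simp add: q_def sum_distrib_left del: sum.lessThan_Suc of_real_power)
  finally have eq: "ip w w = z * complex_of_real q" .
  obtain j where "j < Suc n" "v $ j \<noteq> 0"
    using v by (metis carrier_vecD eq_vecI index_zero_vec)
  hence "q > 0" unfolding q_def by (intro sum_pos2[of _ j]) auto
  hence "z = complex_of_real (Re (ip w w) / q)"
    using eq ip_self[of w] by (simp add: field_simps)
  thus ?thesis by (metis Reals_of_real)
qed

lemma gram_matrix_eigenvalues: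
  shows "finite {x. eigenvalue (gram_matrix ip u n) (complex_of_real x)}"
    and "{x. eigenvalue (gram_matrix ip u n) (complex_of_real x)} \<noteq> {}"
proof -
  have G: "gram_matrix ip u n \<in> carrier_mat (Suc n) (Suc n)"
    by (simp add: gram_matrix_def)
  have "complex_of_real ` {x. eigenvalue (gram_matrix ip u n) (complex_of_real x)}
      \<subseteq> spectrum (gram_matrix ip u n)"
    by (auto simp: spectrum_def)
  then show "finite {x. eigenvalue (gram_matrix ip u n) (complex_of_real x)}"
    using card_finite_spectrum(1)[OF G] by (meson finite_imageD finite_subset inj_of_real subset_UNIV inj_on_subset)
  obtain z where z: "eigenvalue (gram_matrix ip u n) z"
    using spectrum_non_empty[OF G] by (auto simp: spectrum_def)
  with gram_matrix_eigenvalue_real[OF z]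
  show "{x. eigenvalue (gram_matrix ip u n) (complex_of_real x)} \<noteq> {}"
    by (auto elim!: Reals_cases)
qed

lemma gram_schmidt_expansion:
  assumes "lin_indep_seq smul u"
  shows "\<exists>a. (\<forall>n. gram_schmidt_seq smul ip u n = (\<Sum>j\<le>n. smul (a n j) (u j))) \<and>
             (\<forall>n. a n n \<in> \<real> \<and> 0 < Re (a n n))"
proof -
  let ?p = "gram_schmidt_seq smul ip u"
  have inj: "inj u" and ind: "\<not> dependent (range u)"
    using assms by (auto simp: lin_indep_seq_def)
  have "\<exists>b. ?p n = (\<Sum>j\<le>n. smul (b j) (u j)) \<and> b n \<in> \<real> \<and> 0 < Re (b n)" for n
  proof (induction n rule: less_induct)
    case (less n)
    have "\<exists>c. \<forall>k<n. ?p k = (\<Sum>j\<le>k. smul (c k j) (u j))"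
      using less.IH by metis
    then obtain c where c: "\<And>k. k < n \<Longrightarrow> ?p k = (\<Sum>j\<le>k. smul (c k j) (u j))" by blast
    define v where "v = u n - (\<Sum>k<n. smul (ip (u n) (?p k)) (?p k))"
    have "?p k \<in> span (u ` {..<n})" if "k < n" for k
      unfolding c[OF that] using that by (intro span_sum span_scale span_base) auto
    hence s: "(\<Sum>k<n. smul (ip (u n) (?p k)) (?p k)) \<in> span (u ` {..<n})"
      by (intro span_sum span_scale) auto
    then obtain d where d: "(\<Sum>k<n. smul (ip (u n) (?p k)) (?p k)) = (\<Sum>x\<in>u ` {..<n}. smul (d x) x)"
      by (auto simp: span_finite)
    have d': "(\<Sum>x\<in>u ` {..<n}. smul (d x) x) = (\<Sum>j<n. smul (d (u j)) (u j))"
      using inj by (subst sum.reindex) (auto intro: inj_on_subset)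
    have "v \<noteq> 0"
    proof
      assume "v = 0"
      hence "u n \<in> span (u ` {..<n})" using s by (simp add: v_def)
      moreover have "u ` {..<n} \<subseteq> range u - {u n}" using inj by (auto dest: injD)
      ultimately have "u n \<in> span (range u - {u n})" using span_mono by blast
      thus False using ind by (auto simp: dependent_def)
    qed
    hence pos: "0 < Re (ip v v)" by (rule ip_pos)
    define r where "r = 1 / sqrt (Re (ip v v))"
    define b where "b j = (if j = n then of_real r else - of_real r * d (u j))" for j
    have "?p n = smul (of_real r) v"
      by (subst gram_schmidt_seq.simps) (simp add: normalize_vec_def v_def r_def)
    also have "\<dots> = smul (of_real r) (u n) - (\<Sum>j<n. smul (of_real r) (smul (d (u j)) (u j)))"
      by (simp add: v_def d d' scale_right_diff_distrib scale_sum_right)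
    also have "\<dots> = (\<Sum>j\<le>n. smul (b j) (u j))"
      by (simp add: b_def lessThan_Suc_atMost[symmetric] sum_negf)
    finally have "?p n = (\<Sum>j\<le>n. smul (b j) (u j))" .
    moreover have "b n \<in> \<real>" "0 < Re (b n)" using pos by (simp_all add: b_def r_def)
    ultimately show ?case by blast
  qed
  then show ?thesis by metis
qed

end

end

theory Submission
  imports Defs
begin

text \<open>
  Let \<open>v\<close> be an eigenvector of \<open>G\<^sub>n\<close> for \<open>\<lambda>\<close> and put \<open>w = \<Sum>\<^sub>k cnj v\<^sub>k u\<^sub>k\<close>, so that
  \<open>(u\<^sub>j, w) = \<lambda> v\<^sub>j\<close> and \<open>(w, w) = \<lambda> \<parallel>v\<parallel>\<^sup>2 > 0\<close>. By Parseval and Cauchy--Schwarz,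
  \<open>\<lambda> \<parallel>v\<parallel>\<^sup>2 = \<Sum>\<^sub>l |(p\<^sub>l, w)|\<^sup>2 = \<lambda>\<^sup>2 \<Sum>\<^sub>l |\<Sum>\<^sub>j a\<^sub>l\<^sub>j v\<^sub>j|\<^sup>2 \<le> \<lambda>\<^sup>2 \<parallel>v\<parallel>\<^sup>2 \<Sum>\<^sub>l \<Sum>\<^sub>j |a\<^sub>l\<^sub>j|\<^sup>2\<close>,
  which is the first bound. It dominates the second one, as \<open>\<Sum>\<^sub>j |a\<^sub>l\<^sub>j|\<^sup>2 \<le> (\<Sum>\<^sub>j |a\<^sub>l\<^sub>j|)\<^sup>2\<close>.
\<close>

text \<open>Adding an index to the sum creates the cross term \<open>2 * f x * sum f F\<close> in
  the square, which is nonnegative.\<close>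

lemma sum_power2_le_power2_sum:
  fixes f :: "'b \<Rightarrow> 'c::linordered_idom"
  assumes "finite A" and "\<And>i. i \<in> A \<Longrightarrow> 0 \<le> f i"
  shows "(\<Sum>i\<in>A. (f i)\<^sup>2) \<le> (\<Sum>i\<in>A. f i)\<^sup>2"
  using assms
proof (induction A rule: finite_induct)
  case (insert x F)
  have "0 \<le> f x * sum f F"
    using insert.prems by (intro mult_nonneg_nonneg sum_nonneg) auto
  with insert show ?case by (simp add: power2_sum)
qed simp

lemma norm_sum_mult_power2_le:
  fixes f g :: "'b \<Rightarrow> 'c::real_normed_algebra"
  shows "(norm (\<Sum>i\<in>A. f i * g i))\<^sup>2 \<le> (\<Sum>i\<in>A. (norm (f i))\<^sup>2) * (\<Sum>i\<in>A. (norm (g i))\<^sup>2)"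
proof -
  have "norm (\<Sum>i\<in>A. f i * g i) \<le> (\<Sum>i\<in>A. norm (f i) * norm (g i))"
    by (intro sum_norm_le norm_mult_ineq)
  then have "(norm (\<Sum>i\<in>A. f i * g i))\<^sup>2 \<le> (\<Sum>i\<in>A. norm (f i) * norm (g i))\<^sup>2"
    by (rule power_mono) simp
  also have "\<dots> \<le> (\<Sum>i\<in>A. (norm (f i))\<^sup>2) * (\<Sum>i\<in>A. (norm (g i))\<^sup>2)"
    by (rule Cauchy_Schwarz_ineq_sum)
  finally show ?thesis .
qed

context complex_inner_product_space
begin

lemma lin_indep_seqD:
  assumes "lin_indep_seq smul u" and "(\<Sum>j\<le>n. smul (c j) (u j)) = 0" and "j \<le> n"
  shows "c j = 0"
proof -
  have inj: "inj u" and ind: "\<not> dependent (range u)"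
    using assms(1) by (auto simp: lin_indep_seq_def)
  \<comment> \<open>Independence of a set takes coefficients indexed by vectors; injectivity of
    \<open>u\<close> lets \<open>inv_into\<close> recover the index.\<close>
  have "(\<Sum>x\<in>u ` {..n}. smul (c (inv_into UNIV u x)) x) = 0"
    using assms(2) inj by (subst sum.reindex) (auto intro: inj_on_subset)
  with independentD[OF ind, of "u ` {..n}" "\<lambda>x. c (inv_into UNIV u x)" "u j"] assms(3) inj
  show ?thesis by auto
qed

lemma ip_normalize_vec:
  assumes "v \<noteq> 0"
  shows "ip (normalize_vec smul ip v) (normalize_vec smul ip v) = 1"
proof -
  define t where "t = Re (ip v v)"
  have "t > 0" using ip_pos[OF assms] by (simp add: t_def)
  have "ip v v = of_real t" using ip_self by (simp add: t_def)
  then have "ip (normalize_vec smul ip v) (normalize_vec smul ip v)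
      = of_real (1 / sqrt t * (1 / sqrt t) * t)"
    unfolding normalize_vec_def t_def[symmetric]
    by (simp only: ip_scale_left ip_scale_right complex_cnj_complex_of_real of_real_mult mult.assoc)
  also have "1 / sqrt t * (1 / sqrt t) * t = 1"
    using \<open>t > 0\<close> by simp
  finally show ?thesis by simp
qed

context
  fixes u :: "nat \<Rightarrow> 'a"
  assumes indep: "lin_indep_seq smul u"
begin

abbreviation "p \<equiv> gram_schmidt_seq smul ip u"

definition residual :: "nat \<Rightarrow> 'a" where
  "residual m = u m - (\<Sum>k<m. smul (ip (u m) (p k)) (p k))"

lemma gram_schmidt_seq_residual: "p m = normalize_vec smul ip (residual m)"
  by (subst gram_schmidt_seq.simps) (simp add: residual_def)

text \<open>The coefficient of \<open>u m\<close> in \<open>p m\<close> is positive, which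
  independence forbids for a zero combination. Since normalization fixes 0, the residual is then
  nonzero too.\<close>

lemma gram_schmidt_seq_nonzero: "p m \<noteq> 0"
proof
  assume "p m = 0"
  obtain b where "p m = (\<Sum>j\<le>m. smul (b m j) (u j))" and "0 < Re (b m m)"
    using gram_schmidt_expansion[OF indep] by metis
  with \<open>p m = 0\<close> lin_indep_seqD[OF indep, of "b m" m m] show False by simp
qed

lemma residual_nonzero: "residual m \<noteq> 0"
  using gram_schmidt_seq_nonzero[of m] by (auto simp: gram_schmidt_seq_residual normalize_vec_def)

lemma ip_gram_schmidt_self: "ip (p m) (p m) = 1"
  by (simp add: gram_schmidt_seq_residual ip_normalize_vec residual_nonzero)

lemma ip_gram_schmidt_less: "k < m \<Longrightarrow> ip (p m) (p k) = 0"
proof (induction m arbitrary: k rule: less_induct)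
  case (less m)
  \<comment> \<open>The induction hypothesis covers pairs whose first index is larger; conjugate
    symmetry supplies the other order. Only the projection along \<open>p k\<close> then survives in
    the residual's product with \<open>p k\<close>.\<close>
  have orth: "ip (p j) (p k) = (if j = k then 1 else 0)" if "j < m" for j
  proof (cases j k rule: linorder_cases)
    case less
    with less.IH[OF \<open>k < m\<close> less] ip_commute[of "p k" "p j"] show ?thesis by simp
  next
    case greater
    with less.IH[OF that greater] show ?thesis by simp
  qed (simp add: ip_gram_schmidt_self)
  have "ip (residual m) (p k) = ip (u m) (p k) - (\<Sum>j<m. ip (u m) (p j) * ip (p j) (p k))"
    by (simp add: residual_def ip_minus_left ip_sum_left ip_scale_left)
  also have "(\<Sum>j<m. ip (u m) (p j) * ip (p j) (p k)) = (\<Sum>j<m. if j = k then ip (u m) (p j) else 0)"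
    by (intro sum.cong) (auto simp: orth)
  also have "\<dots> = ip (u m) (p k)" using \<open>k < m\<close> by simp
  finally show ?case
    by (simp add: gram_schmidt_seq_residual[of m] normalize_vec_def ip_scale_left)
qed

lemma ip_gram_schmidt: "ip (p j) (p k) = (if j = k then 1 else 0)"
proof (cases j k rule: linorder_cases)
  case less
  with ip_commute[of "p k" "p j"] show ?thesis by (simp add: ip_gram_schmidt_less)
qed (auto simp: ip_gram_schmidt_less ip_gram_schmidt_self)

lemma in_span_gram_schmidt:
  assumes "m \<le> n"
  shows "u m \<in> span (p ` {..n})"
proof -
  \<comment> \<open>The norm of the residual: scaling by it undoes the normalization, so the
    recursion can be solved for \<open>u m\<close>.\<close>
  define r where "r = sqrt (Re (ip (residual m) (residual m)))"
  have "r > 0" using ip_pos[OF residual_nonzero[of m]] by (simp add: r_def)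
  then have "smul (of_real r) (p m) = residual m"
    by (simp add: gram_schmidt_seq_residual[of m] normalize_vec_def flip: r_def)
  then have "u m = smul (of_real r) (p m) + (\<Sum>k<m. smul (ip (u m) (p k)) (p k))"
    by (simp add: residual_def)
  also have "\<dots> \<in> span (p ` {..n})"
    using assms by (intro span_add span_sum span_scale span_base) auto
  finally show ?thesis .
qed

text \<open>Both sides are linear in \<open>w\<close>, so it suffices to check
  \<open>w = p k\<close>, where orthonormality leaves only the term \<open>l = k\<close>.\<close>

lemma gram_schmidt_parseval:
  assumes "w \<in> span (u ` {..n})"
  shows "ip w z = (\<Sum>l\<le>n. ip w (p l) * ip (p l) z)"
proof -
  have "span (u ` {..n}) \<subseteq> span (p ` {..n})"
    by (intro span_minimal) (auto intro: in_span_gram_schmidt)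
  with assms have "w \<in> span (p ` {..n})" by blast
  then show ?thesis
  proof (induction rule: span_induct_alt)
    case base
    show ?case by (simp add: ip_zero_left)
  next
    case (step c x y)
    then obtain k where k: "x = p k" "k \<le> n" by auto
    have "(\<Sum>l\<le>n. ip x (p l) * ip (p l) z) = (\<Sum>l\<le>n. if l = k then ip (p l) z else 0)"
      by (intro sum.cong) (auto simp: k ip_gram_schmidt)
    also have "\<dots> = ip x z" using k by simp
    finally show ?case
      using step.IH
      by (simp add: ip_add_left ip_scale_left ring_distribs sum.distrib mult.assoc flip: sum_distrib_left)
  qed
qed

lemma gram_matrix_eigenvalue_ge:
  assumes ev: "eigenvalue (gram_matrix ip u n) (complex_of_real x)"
    and a: "\<And>l. l \<le> n \<Longrightarrow> p l = (\<Sum>j\<le>l. smul (a l j) (u j))"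
  shows "1 \<le> x * (\<Sum>l\<le>n. \<Sum>j\<le>l. (cmod (a l j))\<^sup>2)"
proof -
  from ev obtain v where v: "v \<in> carrier_vec (Suc n)" "v \<noteq> 0\<^sub>v (Suc n)"
    and eq: "gram_matrix ip u n *\<^sub>v v = of_real x \<cdot>\<^sub>v v"
    by (auto simp: eigenvalue_def eigenvector_def gram_matrix_def)
  \<comment> \<open>The conjugates cancel those from the second argument of \<open>ip\<close>, so
    that \<open>ip (u j) w\<close> is the \<open>j\<close>-th entry of the Gram matrix times
    \<open>v\<close>.\<close>
  define w where "w = (\<Sum>k\<le>n. smul (cnj (v $ k)) (u k))"
  define q :: real where "q = (\<Sum>k\<le>n. (cmod (v $ k))\<^sup>2)"
  define S where "S = (\<Sum>l\<le>n. \<Sum>j\<le>l. (cmod (a l j))\<^sup>2)"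
  have uw: "ip (u j) w = of_real x * v $ j" if "j \<le> n" for j
  proof -
    have "ip (u j) w = (\<Sum>k\<le>n. ip (u j) (u k) * v $ k)"
      by (simp add: w_def ip_sum_right ip_scale_right mult.commute)
    also have "\<dots> = (gram_matrix ip u n *\<^sub>v v) $ j"
      using v that
      by (auto simp: gram_matrix_def scalar_prod_def atLeast0LessThan lessThan_Suc_atMost
          intro!: sum.cong)
    also have "\<dots> = of_real x * v $ j"
      using eq v that by simp
    finally show ?thesis .
  qed
  have "ip w w = (\<Sum>j\<le>n. cnj (v $ j) * ip (u j) w)"
    by (subst w_def) (simp add: ip_sum_left ip_scale_left)
  also have "\<dots> = (\<Sum>j\<le>n. of_real x * of_real ((cmod (v $ j))\<^sup>2))"
    by (intro sum.cong) (auto simp: uw complex_norm_square mult_ac simp del: of_real_power)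
  finally have ww: "ip w w = of_real (x * q)"
    by (simp add: q_def sum_distrib_left)
  obtain j where j: "j \<le> n" "v $ j \<noteq> 0"
    using v by (metis carrier_vecD eq_vecI index_zero_vec less_Suc_eq_le)
  then have "q > 0" unfolding q_def by (intro sum_pos2[of _ j]) auto
  \<comment> \<open>This makes \<open>x * q\<close>, the squared norm of \<open>w\<close>, positive;
    it is the factor cancelled at the end.\<close>
  have "w \<noteq> 0"
    using lin_indep_seqD[OF indep, of "\<lambda>k. cnj (v $ k)" n j] j by (auto simp: w_def)
  then have "x * q > 0" using ip_pos[of w] ww by simp
  have pw: "(cmod (ip (p l) w))\<^sup>2 \<le> x\<^sup>2 * q * (\<Sum>j\<le>l. (cmod (a l j))\<^sup>2)" if "l \<le> n" for l
  proof -
    have "ip (p l) w = of_real x * (\<Sum>j\<le>l. a l j * v $ j)"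
      using that by (simp add: a ip_sum_left ip_scale_left uw sum_distrib_left mult_ac)
    then have "(cmod (ip (p l) w))\<^sup>2 = x\<^sup>2 * (cmod (\<Sum>j\<le>l. a l j * v $ j))\<^sup>2"
      by (simp add: norm_mult power_mult_distrib)
    also have "\<dots> \<le> x\<^sup>2 * ((\<Sum>j\<le>l. (cmod (a l j))\<^sup>2) * (\<Sum>j\<le>l. (cmod (v $ j))\<^sup>2))"
      by (intro mult_left_mono norm_sum_mult_power2_le) simp
    \<comment> \<open>Extending the sum over \<open>v\<close> from \<open>l\<close> to
      \<open>n\<close> gives the factor \<open>q\<close>, which does not depend on
      \<open>l\<close>.\<close>
    also have "\<dots> \<le> x\<^sup>2 * ((\<Sum>j\<le>l. (cmod (a l j))\<^sup>2) * q)"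
      unfolding q_def using that by (intro mult_left_mono sum_mono2 sum_nonneg) auto
    finally show ?thesis by (simp add: mult_ac)
  qed
  have "w \<in> span (u ` {..n})"
    unfolding w_def by (intro span_sum span_scale span_base) auto
  then have "ip w w = (\<Sum>l\<le>n. ip w (p l) * ip (p l) w)"
    by (rule gram_schmidt_parseval)
  also have "\<dots> = (\<Sum>l\<le>n. of_real ((cmod (ip (p l) w))\<^sup>2))"
    by (intro sum.cong refl) (subst ip_commute, simp only: complex_norm_square mult.commute)
  finally have "x * q = (\<Sum>l\<le>n. (cmod (ip (p l) w))\<^sup>2)"
    unfolding ww of_real_sum[symmetric] of_real_eq_iff .
  also have "\<dots> \<le> (\<Sum>l\<le>n. x\<^sup>2 * q * (\<Sum>j\<le>l. (cmod (a l j))\<^sup>2))"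
    by (intro sum_mono pw) simp
  also have "\<dots> = (x * q) * (x * S)"
    by (simp add: S_def sum_distrib_left power2_eq_square mult_ac)
  finally have "(x * q) * 1 \<le> (x * q) * (x * S)" by simp
  then show ?thesis
    using \<open>x * q > 0\<close> unfolding S_def by (rule mult_left_le_imp_le)
qed

end

end

theorem theorem2:
  fixes smul :: "complex \<Rightarrow> 'a::ab_group_add \<Rightarrow> 'a"
    and ip :: "'a \<Rightarrow> 'a \<Rightarrow> complex"
    and u :: "nat \<Rightarrow> 'a"
    and a :: "nat \<Rightarrow> nat \<Rightarrow> complex"
    and n :: nat
  assumes "complex_inner_product_space smul ip"
    and "lin_indep_seq smul u"
    and "\<And>m. gram_schmidt_seq smul ip u m = (\<Sum>j\<le>m. smul (a m j) (u j))"
    and "\<And>m. a m m \<in> \<real> \<and> 0 < Re (a m m)"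
  shows "smallest_eigenvalue (gram_matrix ip u n) \<ge>
    max (1 / (\<Sum>l\<le>n. \<Sum>j\<le>l. (cmod (a l j))\<^sup>2))
        (1 / (\<Sum>l\<le>n. (\<Sum>j\<le>l. cmod (a l j))\<^sup>2))"
proof -
  interpret complex_inner_product_space smul ip by fact
  define S where "S = (\<Sum>l\<le>n. \<Sum>j\<le>l. (cmod (a l j))\<^sup>2)"
  define T where "T = (\<Sum>l\<le>n. (\<Sum>j\<le>l. cmod (a l j))\<^sup>2)"
  define x where "x = smallest_eigenvalue (gram_matrix ip u n)"
  \<comment> \<open>The minimum of a finite nonempty set belongs to it, so the bound for arbitrary
    real eigenvalues applies.\<close>
  have "eigenvalue (gram_matrix ip u n) (complex_of_real x)"
    using Min_in[OF gram_matrix_eigenvalues[of u n]] by (simp add: x_def smallest_eigenvalue_def)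
  then have "1 \<le> x * S"
    unfolding S_def by (rule gram_matrix_eigenvalue_ge[OF assms(2)]) (rule assms(3))
  moreover have "S \<ge> 0"
    unfolding S_def by (intro sum_nonneg) simp
  \<comment> \<open>\<open>S = 0\<close> would turn the eigenvalue bound into
    \<open>1 \<le> 0\<close>.\<close>
  ultimately have "S > 0"
    by (cases "S = 0") auto
  have "S \<le> T"
    unfolding S_def T_def by (intro sum_mono sum_power2_le_power2_sum) auto
  then have "1 / T \<le> 1 / S"
    using \<open>S > 0\<close> by (intro divide_left_mono) auto
  moreover have "1 / S \<le> x"
    using \<open>1 \<le> x * S\<close> \<open>S > 0\<close> by (simp add: divide_le_eq)
  ultimately show ?thesis
    by (simp add: S_def T_def x_def)
qed

end
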